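(* For all even $k\ge4$ we have $$\zeta_q(k)=2^{k-1}\sum_{\substack{r+s=k\\ r\ge1,\,s\ge2}}\hat\zeta_q(r,s)-E_k(q),$$ where $E_k(q)\in\mathbb{Q}[[q]]$ is the $q$-series $$E_k(q)=2^{k-2}\zeta_q(k-1)-\frac{2^{k-2}}{k-2}\,q\frac{d}{dq}\zeta_q(k-2)+\sum_{j=2}^{k-2}\frac{2^jB_j}{j!}\zeta_q(k-j)+\sum_{\substack{0\le j\le k-2\\ 1\le l\le k-j-1\\ (l,j)\ne(1,0)}}\frac{(-1)^l2^jB_j}{j!\,l!}\,\zeta^{\mathbf o}_q(k-j-l).$$
   Context: For $k\ge1$ let $Q_k(t)\in t\mathbb{Q}[t]$ be the polynomial defined by $\frac{Q_k(t)}{(1-t)^k}=\frac{1}{(k-1)!}\sum_{d>0}d^{k-1}t^d$. For $k,r,s\ge1$ define the $q$-series in $\mathbb{Q}[[q]]$ $$\zeta_q(k)=\sum_{n>0}\frac{Q_k(q^n)}{(1-q^n)^k},\qquad \hat\zeta_q(r,s)=\sum_{0<n<m}\frac{Q_r(q^{n+m})}{(1-q^{n+m})^r}\,\frac{Q_s(q^m)}{(1-q^m)^s},\qquad \zeta^{\mathbf o}_q(k)=\sum_{\substack{a,d>0\\ d\text{ odd}}}\frac{d^{k-1}}{(k-1)!}q^{ad}.$$ $B_j$ denotes the Bernoulli numbers with the convention $B_1=+\tfrac12$. *)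

theory Defs
  imports "HOL-Analysis.Analysis" "HOL-Computational_Algebra.Polynomial_FPS"
begin

definition Q_poly :: "nat \<Rightarrow> rat poly" where
  "Q_poly k = (THE p. coeff p 0 = 0 \<and>
     fps_of_poly p / (1 - fps_X) ^ k =
       fps_const (1 / fact (k - 1)) * Abs_fps (\<lambda>d. if d > 0 then of_nat d ^ (k - 1) else 0))"

text \<open>The value of \<open>Q\<^sub>k(t) / (1 - t)\<^sup>k\<close> at \<open>t = q\<^sup>n\<close>, for \<open>n > 0\<close>.\<close>
definition Q_term :: "nat \<Rightarrow> nat \<Rightarrow> rat fps" where
  "Q_term k n = (fps_of_poly (Q_poly k) oo fps_X ^ n) / (1 - fps_X ^ n) ^ k"

text \<open>All infinite sums below are unconditional sums in the \<open>q\<close>-adic topology of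
  \<open>\<rat>[[q]]\<close>, which is the topology of the metric on \<^typ>\<open>rat fps\<close>.\<close>

definition zeta_q :: "nat \<Rightarrow> rat fps" where
  "zeta_q k = (\<Sum>\<^sub>\<infinity>n\<in>{0<..}. Q_term k n)"

definition zeta_hat_q :: "nat \<Rightarrow> nat \<Rightarrow> rat fps" where
  "zeta_hat_q r s = (\<Sum>\<^sub>\<infinity>(n, m)\<in>{(n, m). 0 < n \<and> n < m}. Q_term r (n + m) * Q_term s m)"

definition zeta_odd_q :: "nat \<Rightarrow> rat fps" where
  "zeta_odd_q k = (\<Sum>\<^sub>\<infinity>(a, d)\<in>{(a, d). 0 < a \<and> 0 < d \<and> odd d}.
     fps_const (of_nat d ^ (k - 1) / fact (k - 1)) * fps_X ^ (a * d))"

text \<open>Bernoulli numbers with \<open>B\<^sub>1 = 1/2\<close>: the exponential generating function is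
  \<open>x / (1 - e\<^sup>-\<^sup>x)\<close>, not \<open>x / (e\<^sup>x - 1)\<close>.\<close>
definition bernoulli :: "nat \<Rightarrow> rat" where
  "bernoulli j = fact j * fps_nth (fps_X / (1 - fps_exp (- 1))) j"

definition E_q :: "nat \<Rightarrow> rat fps" where
  "E_q k =
     fps_const (2 ^ (k - 2)) * zeta_q (k - 1)
     - fps_const (2 ^ (k - 2) / of_nat (k - 2)) * (fps_X * fps_deriv (zeta_q (k - 2)))
     + (\<Sum>j = 2..k - 2. fps_const (2 ^ j * bernoulli j / fact j) * zeta_q (k - j))
     + (\<Sum>(j, l)\<in>{(j, l). j \<le> k - 2 \<and> 1 \<le> l \<and> l \<le> k - j - 1 \<and> (l, j) \<noteq> (1, 0)}.
          fps_const ((- 1) ^ l * 2 ^ j * bernoulli j / (fact j * fact l)) * zeta_odd_q (k - j - l))"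

subsection \<open>Well-definedness\<close>

lemma Q_poly_exists:
  "\<exists>p :: rat poly. coeff p 0 = 0 \<and>
     fps_of_poly p = (1 - fps_X) ^ Suc i * Abs_fps (\<lambda>d. if d > 0 then of_nat d ^ i else 0)"
proof (induction i)
  case 0
  have "fps_of_poly [:0, 1 :: rat:] = (1 - fps_X) ^ Suc 0 * Abs_fps (\<lambda>d. if d > 0 then of_nat d ^ 0 else 0)"
    by (rule fps_ext) (auto simp: left_diff_distrib coeff_pCons split: nat.splits)
  then show ?case by (intro exI[of _ "[:0, 1:]"]) simp
next
  case (Suc i)
  then obtain p where p: "coeff p 0 = 0" "fps_of_poly p =
     (1 - fps_X) ^ Suc i * Abs_fps (\<lambda>d. if d > 0 then of_nat d ^ i else (0::rat))" by blast
  define A :: "rat fps" where "A = Abs_fps (\<lambda>d. if d > 0 then of_nat d ^ i else 0)"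
  have A': "Abs_fps (\<lambda>d. if d > 0 then of_nat d ^ Suc i else 0) = fps_X * fps_deriv A"
    by (rule fps_ext) (auto simp: A_def)
  define r where "r = [:0, 1:] * ([:1, -1:] * pderiv p + smult (of_nat (Suc i)) p)"
  have d: "fps_deriv (fps_of_poly p) = (1 - fps_X) ^ Suc i * fps_deriv A
     - of_nat (Suc i) * (1 - fps_X) ^ i * A"
  proof -
    have c: "fps_const (- 1 - of_nat i) = (- 1 - of_nat i :: rat fps)"
      by (simp flip: fps_const_sub fps_const_neg fps_of_nat)
    show ?thesis
      unfolding p(2) A_def[symmetric]
      by (simp add: fps_deriv_power c algebra_simps del: power_Suc)
  qed
  have "fps_of_poly r = fps_X * ((1 - fps_X) * fps_deriv (fps_of_poly p) + of_nat (Suc i) * fps_of_poly p)"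
  proof -
    have "fps_of_poly [:0, 1 :: rat:] = fps_X" "fps_of_poly [:1, -1 :: rat:] = 1 - fps_X"
      by (rule fps_ext; auto simp: coeff_pCons fps_X_def split: nat.splits)+
    then show ?thesis
      unfolding r_def fps_of_poly_mult fps_of_poly_add fps_of_poly_pderiv fps_of_poly_smult
      by (simp only: fps_of_nat)
  qed
  also have "\<dots> = (1 - fps_X) ^ Suc (Suc i) * (fps_X * fps_deriv A)"
    unfolding d unfolding p(2) A_def[symmetric] by (simp add: algebra_simps)
  finally show ?case unfolding A' by (intro exI[of _ r]) (simp add: r_def)
qed

lemma Q_poly:
  assumes "k \<ge> 1"
  shows "coeff (Q_poly k) 0 = 0"
    and "fps_of_poly (Q_poly k) / (1 - fps_X) ^ k =
       fps_const (1 / fact (k - 1)) * Abs_fps (\<lambda>d. if d > 0 then of_nat d ^ (k - 1) else 0)"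
proof -
  define D where "D = Abs_fps (\<lambda>d. if d > 0 then of_nat d ^ (k - 1) else (0::rat))"
  have u: "is_unit ((1 - fps_X :: rat fps) ^ k)"
    by (simp add: fps_is_unit_iff fps_nth_power_0)
  then have nz: "(1 - fps_X :: rat fps) ^ k \<noteq> 0"
    using not_is_unit_0 by metis
  from Q_poly_exists[of "k - 1"] assms obtain p where
    p: "coeff p 0 = 0" "fps_of_poly p = (1 - fps_X) ^ k * D"
    unfolding D_def by auto
  define p' where "p' = smult (1 / fact (k - 1)) p"
  have "\<exists>!p. coeff p 0 = 0 \<and> fps_of_poly p / (1 - fps_X) ^ k = fps_const (1 / fact (k - 1)) * D"
  proof (rule ex1I[of _ p'])
    have "fps_of_poly p' = (1 - fps_X) ^ k * (fps_const (1 / fact (k - 1)) * D)"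
      by (simp add: p'_def fps_of_poly_smult p(2) mult_ac)
    then show "coeff p' 0 = 0 \<and> fps_of_poly p' / (1 - fps_X) ^ k = fps_const (1 / fact (k - 1)) * D"
      using nz p(1) by (simp add: p'_def)
  next
    fix p2 assume "coeff p2 0 = 0 \<and> fps_of_poly p2 / (1 - fps_X) ^ k = fps_const (1 / fact (k - 1)) * D"
    then have "fps_of_poly p2 = (1 - fps_X) ^ k * (fps_const (1 / fact (k - 1)) * D)"
      using u by (metis dvd_mult_div_cancel unit_imp_dvd)
    also have "\<dots> = fps_of_poly p'" by (simp add: p'_def fps_of_poly_smult p(2) mult_ac)
    finally show "p2 = p'" by (simp add: fps_of_poly_eq_iff)
  qed
  from theI'[OF this] show "coeff (Q_poly k) 0 = 0"
    and "fps_of_poly (Q_poly k) / (1 - fps_X) ^ k =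
       fps_const (1 / fact (k - 1)) * Abs_fps (\<lambda>d. if d > 0 then of_nat d ^ (k - 1) else 0)"
    unfolding Q_poly_def D_def by auto
qed

lemma fps_has_sumI:
  fixes f :: "'i \<Rightarrow> rat fps"
  assumes fin: "\<And>N. finite {x \<in> A. fps_nth (f x) N \<noteq> 0}"
  shows "(f has_sum Abs_fps (\<lambda>N. \<Sum>x | x \<in> A \<and> fps_nth (f x) N \<noteq> 0. fps_nth (f x) N)) A"
  unfolding has_sum_def
proof (rule tendsto_fpsI)
  fix N
  show "\<forall>\<^sub>F F in finite_subsets_at_top A. fps_nth (sum f F) N =
      fps_nth (Abs_fps (\<lambda>N. \<Sum>x | x \<in> A \<and> fps_nth (f x) N \<noteq> 0. fps_nth (f x) N)) N"
    unfolding eventually_finite_subsets_at_top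
    by (intro exI[of _ "{x \<in> A. fps_nth (f x) N \<noteq> 0}"] conjI fin)
       (auto simp: fps_sum_nth intro!: sum.mono_neutral_right)
qed

lemma Q_term_nth_eq_0:
  assumes "k \<ge> 1" "N < n"
  shows "fps_nth (Q_term k n) N = 0"
proof -
  have n: "n > 0" using assms by simp
  have "(fps_of_poly (Q_poly k) :: rat fps) = fps_X * fps_shift 1 (fps_of_poly (Q_poly k))"
    using Q_poly(1)[OF assms(1)] by (intro fps_ext) (auto simp: gr0_conv_Suc)
  then have "fps_of_poly (Q_poly k) oo fps_X ^ n =
      (fps_X oo fps_X ^ n) * (fps_shift 1 (fps_of_poly (Q_poly k)) oo fps_X ^ n)"
    using n by (metis fps_compose_mult_distrib fps_X_power_nth gr_implies_not0)
  then have c: "fps_of_poly (Q_poly k) oo fps_X ^ n =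
      fps_X ^ n * (fps_shift 1 (fps_of_poly (Q_poly k)) oo fps_X ^ n)"
    using n by simp
  have "is_unit ((1 - fps_X ^ n :: rat fps) ^ k)"
    using n by (simp add: fps_is_unit_iff fps_nth_power_0 power_0_left)
  then have "Q_term k n = fps_X ^ n *
      ((fps_shift 1 (fps_of_poly (Q_poly k)) oo fps_X ^ n) / (1 - fps_X ^ n) ^ k)"
    unfolding Q_term_def c by (simp add: unit_div_mult_swap mult.commute)
  then show ?thesis using assms(2) by (simp add: fps_X_power_mult_nth)
qed

lemma zeta_q_summable:
  assumes "k \<ge> 1"
  shows "Q_term k summable_on {0<..}"
proof -
  have "finite {n \<in> {0<..}. fps_nth (Q_term k n) N \<noteq> 0}" for N
  proof (rule finite_subset)
    show "{n \<in> {0<..}. fps_nth (Q_term k n) N \<noteq> 0} \<subseteq> {..N}"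
      using Q_term_nth_eq_0[OF assms, of N] not_le by blast
  qed simp
  from fps_has_sumI[OF this] show ?thesis by (rule has_sum_imp_summable)
qed

lemma zeta_hat_q_summable:
  assumes "r \<ge> 1" "s \<ge> 1"
  shows "(\<lambda>(n, m). Q_term r (n + m) * Q_term s m) summable_on {(n, m). 0 < n \<and> n < m}"
proof -
  have "finite {x \<in> {(n, m). 0 < n \<and> n < m}.
      fps_nth ((\<lambda>(n, m). Q_term r (n + m) * Q_term s m) x) N \<noteq> 0}" for N
  proof (rule finite_subset)
    have "fps_nth (Q_term r (n + m) * Q_term s m) N = 0" if "m > N" for n m
      using Q_term_nth_eq_0[OF assms(2)] that by (auto simp: fps_mult_nth intro!: sum.neutral)
    then show "{x \<in> {(n, m). 0 < n \<and> n < m}.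
      fps_nth ((\<lambda>(n, m). Q_term r (n + m) * Q_term s m) x) N \<noteq> 0} \<subseteq> {..N} \<times> {..N}"
      by clarsimp (meson le_less_trans less_imp_le not_le)
  qed simp
  from fps_has_sumI[OF this] show ?thesis by (rule has_sum_imp_summable)
qed

lemma zeta_odd_q_summable:
  "(\<lambda>(a, d). fps_const (of_nat d ^ (k - 1) / fact (k - 1) :: rat) * fps_X ^ (a * d))
     summable_on {(a, d). 0 < a \<and> 0 < d \<and> odd d}"
proof -
  have "finite {x \<in> {(a, d). 0 < a \<and> 0 < d \<and> odd d}. fps_nth ((\<lambda>(a, d).
      fps_const (of_nat d ^ (k - 1) / fact (k - 1) :: rat) * fps_X ^ (a * d)) x) N \<noteq> 0}" for N
    by (rule finite_subset[of _ "{..N} \<times> {..N}"]) (auto split: if_splits)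
  from fps_has_sumI[OF this] show ?thesis by (rule has_sum_imp_summable)
qed

lemma bernoulli_1: "bernoulli 1 = 1 / 2"
proof -
  define G :: "rat fps" where "G = fps_X / (1 - fps_exp (- 1))"
  define H :: "rat fps" where "H = fps_shift 1 (1 - fps_exp (- 1))"
  have H: "1 - fps_exp (- 1) = fps_X * H"
    by (rule fps_ext) (auto simp: H_def gr0_conv_Suc)
  have H0: "fps_nth H 0 = 1" "fps_nth H 1 = - 1 / 2" by (simp_all add: H_def)
  have "G = 1 / H" unfolding G_def H using H0 
    by (metis div_mult_mult1 mult.right_neutral fps_X_neq_zero)
  moreover have "is_unit H" using H0 by (simp add: fps_is_unit_iff)
  ultimately have GH: "G * H = 1" by simp
  from arg_cong[OF GH, of "\<lambda>f. fps_nth f 0"] arg_cong[OF GH, of "\<lambda>f. fps_nth f 1"]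
  have "fps_nth G 1 = 1 / 2" using H0 by (simp add: fps_mult_nth_1)
  then show ?thesis by (simp add: bernoulli_def G_def)
qed

end

theory Submission
  imports Defs
begin

text \<open>Compare coefficients of \<open>q\<^sup>N\<close>. By the binomial theorem, with \<open>f = d + e\<close>, the sum of the
  \<open>zeta_hat_q r s\<close> has the coefficient \<open>\<Sum> (f\<^bsup>k-2\<^esup> - d\<^bsup>k-2\<^esup>) / (k-2)!\<close> over the solutions of
  \<open>d n + f m = N\<close> with \<open>n < m\<close> and \<open>d < f\<close>. A Liouville-type cancellation leaves only the diagonals
  \<open>n = m\<close> and \<open>d = f\<close>, which are divisor sums: one of \<open>d\<^bsup>k-2\<^esup>\<close> weighted by \<open>\<lfloor>(N/d - 1)/2\<rfloor>\<close>, giving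
  the first two terms of \<open>E_q k\<close>, and one of the power sums over \<open>0 < f < D/2\<close> for \<open>D\<close> dividing \<open>N\<close>.
  Faulhaber's formula at \<open>D/2\<close> for even \<open>D\<close>, and at \<open>(D-1)/2\<close> with the powers of \<open>D - 1\<close> expanded for
  odd \<open>D\<close>, turns the latter into the Bernoulli sums.\<close>

section \<open>Coefficients of the single series as sums over factorisations of
  \<open>N\<close>\<close>

text \<open>Sums converge \<open>q\<close>-adically as soon as each exponent receives finitely many
  nonzero contributions. \<open>B\<close> is a family over all \<open>N\<close> because convergence
  needs this at every exponent, not only at the one read off.\<close>

lemma fps_nth_infsum:
  fixes f :: "'i \<Rightarrow> rat fps"
  assumes "\<And>N. finite (B N)" "\<And>N. B N \<subseteq> A"
    and "\<And>N x. x \<in> A - B N \<Longrightarrow> fps_nth (f x) N = 0"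
  shows "fps_nth (\<Sum>\<^sub>\<infinity>x\<in>A. f x) N = (\<Sum>x\<in>B N. fps_nth (f x) N)"
proof -
  have sub: "{x \<in> A. fps_nth (f x) N \<noteq> 0} \<subseteq> B N" for N
    using assms(3) by blast
  have "fps_nth (\<Sum>\<^sub>\<infinity>x\<in>A. f x) N = (\<Sum>x | x \<in> A \<and> fps_nth (f x) N \<noteq> 0. fps_nth (f x) N)"
    using infsumI[OF fps_has_sumI, of A f] finite_subset[OF sub assms(1)] by simp
  also have "\<dots> = (\<Sum>x\<in>B N. fps_nth (f x) N)"
    using assms(2)[of N] by (intro sum.mono_neutral_left assms(1) sub) auto
  finally show ?thesis .
qed

lemma finite_nat_times_eq: "0 < n \<Longrightarrow> finite {d::nat. 0 < d \<and> d * n = N}"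
  by (rule finite_subset[of _ "{..N}"]) auto

text \<open>Composition with \<open>fps_X ^ n\<close> is a ring homomorphism, so it carries the
  defining identity of \<open>Q_poly k\<close> over to \<open>t = q^n\<close>. At most one
  \<open>d\<close> contributes; the sum form lets it merge with outer sums.\<close>

lemma Q_term_nth:
  assumes "k \<ge> 1" "n > 0"
  shows "fps_nth (Q_term k n) N = (\<Sum>d | 0 < d \<and> d * n = N. of_nat d ^ (k - 1) / fact (k - 1))"
proof -
  define A :: "rat fps" where
    "A = fps_const (1 / fact (k - 1)) * Abs_fps (\<lambda>d. if d > 0 then of_nat d ^ (k - 1) else 0)"
  have u: "is_unit ((1 - fps_X :: rat fps) ^ k)" "is_unit ((1 - fps_X ^ n :: rat fps) ^ k)"
    using assms by (simp_all add: fps_is_unit_iff fps_nth_power_0 power_0_left)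
  have X0: "fps_nth (fps_X ^ n :: rat fps) 0 = 0"
    using assms by simp
  have "fps_of_poly (Q_poly k) = (1 - fps_X) ^ k * A"
    using Q_poly(2)[OF assms(1)] u(1) unfolding A_def by (metis dvd_mult_div_cancel unit_imp_dvd)
  then have "fps_of_poly (Q_poly k) oo fps_X ^ n = (1 - fps_X ^ n) ^ k * (A oo fps_X ^ n)"
    using X0 by (simp only: fps_compose_mult_distrib fps_compose_power[symmetric] fps_compose_sub_distrib
        fps_compose_1 fps_X_fps_compose_startby0)
  then have Q: "Q_term k n = A oo fps_X ^ n"
    using u(2) unfolding Q_term_def
    by (metis nonzero_mult_div_cancel_left not_is_unit_0)
  have "fps_nth (Q_term k n) N = (\<Sum>d\<in>{0..N}. fps_nth A d * (if N = n * d then 1 else 0))"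
    unfolding Q by (simp add: fps_compose_nth fps_X_power_nth flip: power_mult)
  also have "\<dots> = (\<Sum>d | 0 < d \<and> d * n = N. of_nat d ^ (k - 1) / fact (k - 1))"
    using assms(2) by (intro sum.mono_neutral_cong_right) (auto simp: A_def split: if_splits)
  finally show ?thesis .
qed

text \<open>Pairs rather than divisors, since both the size and the parity of the cofactor
  \<open>a\<close> enter as weights. The set is empty for \<open>N = 0\<close>, so the constant
  coefficient is no special case.\<close>

definition factor_pairs :: "nat \<Rightarrow> (nat \<times> nat) set" where
  "factor_pairs N = {(a, d). 0 < a \<and> 0 < d \<and> a * d = N}"

lemma finite_factor_pairs: "finite (factor_pairs N)"
  by (rule finite_subset[of _ "{..N} \<times> {..N}"]) (auto simp: factor_pairs_def)

lemma zeta_q_nth: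
  assumes "k \<ge> 1"
  shows "fps_nth (zeta_q k) N = (\<Sum>(a, d)\<in>factor_pairs N. of_nat d ^ (k - 1) / fact (k - 1))"
proof -
  have "fps_nth (zeta_q k) N = (\<Sum>a\<in>{1..N}. fps_nth (Q_term k a) N)"
    unfolding zeta_q_def
    by (rule fps_nth_infsum) (use Q_term_nth_eq_0[OF assms] in auto)
  also have "\<dots> = (\<Sum>a\<in>{1..N}. \<Sum>d | 0 < d \<and> d * a = N. of_nat d ^ (k - 1) / fact (k - 1))"
    by (rule sum.cong) (use Q_term_nth[OF assms] in auto)
  also have "\<dots> = (\<Sum>(a, d)\<in>(SIGMA a:{1..N}. {d. 0 < d \<and> d * a = N}). of_nat d ^ (k - 1) / fact (k - 1))"
    by (rule sum.Sigma) (auto intro: finite_nat_times_eq)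
  also have "(SIGMA a:{1..N}. {d. 0 < d \<and> d * a = N}) = factor_pairs N"
    by (auto simp: factor_pairs_def mult.commute)
  finally show ?thesis .
qed

lemma zeta_odd_q_nth:
  "fps_nth (zeta_odd_q k) N =
     (\<Sum>(a, d)\<in>factor_pairs N. if odd d then of_nat d ^ (k - 1) / fact (k - 1) else 0)"
proof -
  define B where "B N = {(a, d). (a, d) \<in> factor_pairs N \<and> odd d}" for N
  have "finite (B N)" for N
    by (rule finite_subset[OF _ finite_factor_pairs[of N]]) (auto simp: B_def)
  then have "fps_nth (zeta_odd_q k) N = (\<Sum>x\<in>B N. fps_nth ((\<lambda>(a, d).
      fps_const (of_nat d ^ (k - 1) / fact (k - 1) :: rat) * fps_X ^ (a * d)) x) N)"
    unfolding zeta_odd_q_def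
    by (intro fps_nth_infsum) (auto simp: B_def factor_pairs_def split: if_splits)
  also have "\<dots> = (\<Sum>(a, d)\<in>B N. of_nat d ^ (k - 1) / fact (k - 1))"
    by (rule sum.cong) (auto simp: B_def factor_pairs_def)
  also have "\<dots> = (\<Sum>(a, d)\<in>factor_pairs N. if odd d then of_nat d ^ (k - 1) / fact (k - 1) else 0)"
    by (intro sum.mono_neutral_cong_left finite_factor_pairs) (auto simp: B_def split: if_splits)
  finally show ?thesis .
qed

section \<open>Coefficients of the double series\<close>

text \<open>The order constraints are left out so that the set is invariant under exchanging
  \<open>(d, n)\<close> with \<open>(f, m)\<close>.\<close>

definition quads :: "nat \<Rightarrow> (nat \<times> nat \<times> nat \<times> nat) set" where
  "quads N = {(d, n, f, m). 0 < d \<and> 0 < n \<and> 0 < f \<and> 0 < m \<and> d * n + f * m = N}"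

lemma finite_quads: "finite (quads N)"
proof (rule finite_subset)
  show "quads N \<subseteq> {..N} \<times> {..N} \<times> {..N} \<times> {..N}"
    by (auto simp: quads_def) (simp_all add: trans_le_add1 trans_le_add2)
qed simp

lemma Q_term_mult_nth:
  assumes "r \<ge> 1" "s \<ge> 1" "a > 0" "b > 0"
  shows "fps_nth (Q_term r a * Q_term s b) N =
    (\<Sum>(d, e) | 0 < d \<and> 0 < e \<and> d * a + e * b = N.
       of_nat d ^ (r - 1) / fact (r - 1) * (of_nat e ^ (s - 1) / fact (s - 1)))"
proof -
  let ?g = "\<lambda>d e. of_nat d ^ (r - 1) / fact (r - 1) * (of_nat e ^ (s - 1) / fact (s - 1)) :: rat"
  have "fps_nth (Q_term r a * Q_term s b) N =
    (\<Sum>i\<in>{0..N}. \<Sum>(d, e)\<in>{d. 0 < d \<and> d * a = i} \<times> {e. 0 < e \<and> e * b = N - i}. ?g d e)"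
    using assms by (simp add: fps_mult_nth Q_term_nth sum_product sum.cartesian_product)
  also have "\<dots> = (\<Sum>(i, d, e)\<in>(SIGMA i:{0..N}. {d. 0 < d \<and> d * a = i} \<times> {e. 0 < e \<and> e * b = N - i}). ?g d e)"
    using assms by (subst sum.Sigma) (auto intro: finite_nat_times_eq)
  also have "\<dots> = (\<Sum>(d, e) | 0 < d \<and> 0 < e \<and> d * a + e * b = N. ?g d e)"
    by (rule sum.reindex_bij_witness[of _ "\<lambda>(d, e). (d * a, d, e)" "\<lambda>(i, d, e). (d, e)"]) auto
  finally show ?thesis .
qed

lemma finite_nat_linear_eq:
  assumes "0 < a" "0 < b"
  shows "finite {(d::nat, e). 0 < d \<and> 0 < e \<and> d * a + e * b = N}"
proof (rule finite_subset)
  show "{(d, e). 0 < d \<and> 0 < e \<and> d * a + e * b = N} \<subseteq> {..N} \<times> {..N}"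
  proof clarsimp
    fix d e
    have "d \<le> d * a" "e \<le> e * b" using assms by auto
    then show "d \<le> d * a + e * b \<and> e \<le> d * a + e * b" by linarith
  qed
qed simp

text \<open>The two factors contribute the exponents \<open>d * (n + m)\<close> and
  \<open>e * m\<close>, which add up to \<open>d * n + (d + e) * m\<close>; hence
  \<open>f = d + e\<close>.\<close>

lemma zeta_hat_q_nth:
  assumes "r \<ge> 1" "s \<ge> 1"
  shows "fps_nth (zeta_hat_q r s) N =
    (\<Sum>(d, n, f, m) | (d, n, f, m) \<in> quads N \<and> n < m \<and> d < f.
       of_nat d ^ (r - 1) / fact (r - 1) * (of_nat (f - d) ^ (s - 1) / fact (s - 1)))"
proof -
  let ?g = "\<lambda>d e. of_nat d ^ (r - 1) / fact (r - 1) * (of_nat e ^ (s - 1) / fact (s - 1)) :: rat"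
  let ?B = "{(n, m). 0 < n \<and> n < m \<and> m \<le> N}"
  have fin: "finite {(n, m). 0 < n \<and> n < m \<and> m \<le> N}" for N :: nat
    by (rule finite_subset[of _ "{..N} \<times> {..N}"]) auto
  have Q0: "m \<le> N" if "fps_nth (Q_term r (n + m) * Q_term s m) N \<noteq> 0" for n m N
  proof (rule ccontr)
    assume "\<not> m \<le> N"
    then have "fps_nth (Q_term r (n + m) * Q_term s m) N = 0"
      using Q_term_nth_eq_0[OF assms(2)] by (auto simp: fps_mult_nth intro!: sum.neutral)
    with that show False by simp
  qed
  have "fps_nth (zeta_hat_q r s) N = (\<Sum>x\<in>?B. fps_nth ((\<lambda>(n, m). Q_term r (n + m) * Q_term s m) x) N)"
    unfolding zeta_hat_q_def
    by (rule fps_nth_infsum) (use fin in \<open>auto dest: Q0\<close>)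
  also have "\<dots> = (\<Sum>x\<in>?B. \<Sum>(d, e) | 0 < d \<and> 0 < e \<and> d * (fst x + snd x) + e * snd x = N. ?g d e)"
    by (rule sum.cong) (use assms in \<open>auto simp: Q_term_mult_nth\<close>)
  also have "\<dots> = (\<Sum>(x, d, e)\<in>(SIGMA x:?B. {(d, e). 0 < d \<and> 0 < e \<and> d * (fst x + snd x) + e * snd x = N}). ?g d e)"
    by (rule sum.Sigma) (use fin finite_nat_linear_eq in auto)
  also have "\<dots> = (\<Sum>(d, n, f, m) | (d, n, f, m) \<in> quads N \<and> n < m \<and> d < f. ?g d (f - d))"
  proof (rule sum.reindex_bij_witness[of _ "\<lambda>(d, n, f, m). ((n, m), d, f - d)"
        "\<lambda>((n, m), d, e). (d, n, d + e, m)"], goal_cases)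
    case (4 y)
    then obtain d n f m where y: "y = (d, n, f, m)" "(d, n, f, m) \<in> quads N" "n < m" "d < f"
      by (cases y) auto
    \<comment> \<open>An additive witness for \<open>f - d\<close> avoids truncated
      subtraction.\<close>
    then obtain e where "f = d + e" "0 < e" by (metis less_imp_add_positive)
    moreover have "m \<le> N" using y(2) by (auto simp: quads_def intro!: trans_le_add2)
    ultimately show ?case using y by (auto simp: quads_def algebra_simps)
  qed (auto simp: quads_def algebra_simps)
  finally show ?thesis .
qed

lemma binomial_divided:
  fixes x y :: "'a :: field_char_0"
  shows "(x + y) ^ n / fact n = (\<Sum>i\<le>n. x ^ i / fact i * (y ^ (n - i) / fact (n - i)))"
  unfolding binomial_ring sum_divide_distrib by (rule sum.cong) (auto simp: binomial_fact)

text \<open>The exponents \<open>r - 1\<close> and \<open>s - 1\<close> add up to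
  \<open>k - 2\<close>, so the sum over \<open>(r, s)\<close> is a binomial expansion of
  \<open>f = d + (f - d)\<close>. The condition \<open>s \<ge> 2\<close> omits its last term, the
  pure power of \<open>d\<close>, which is the one subtracted.\<close>

lemma sum_zeta_hat_q_nth:
  assumes "k \<ge> 2"
  shows "fps_nth (\<Sum>(r, s)\<in>{(r, s). r + s = k \<and> r \<ge> 1 \<and> s \<ge> 2}. zeta_hat_q r s) N =
    (\<Sum>(d, n, f, m) | (d, n, f, m) \<in> quads N \<and> n < m \<and> d < f.
       (of_nat f ^ (k - 2) - of_nat d ^ (k - 2)) / fact (k - 2))"
proof -
  let ?g = "\<lambda>r s d e. of_nat d ^ (r - 1) / fact (r - 1) * (of_nat e ^ (s - 1) / fact (s - 1)) :: rat"
  let ?R = "{(r, s). r + s = k \<and> r \<ge> 1 \<and> s \<ge> 2}"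
  let ?S = "{(d, n, f, m). (d, n, f, m) \<in> quads N \<and> n < m \<and> d < f}"
  have inner: "(\<Sum>(r, s)\<in>?R. ?g r s d (f - d)) = (of_nat f ^ (k - 2) - of_nat d ^ (k - 2)) / fact (k - 2)"
    if "d < f" for d f
  proof -
    have "(\<Sum>(r, s)\<in>?R. ?g r s d (f - d)) =
        (\<Sum>i<k - 2. of_nat d ^ i / fact i * (of_nat (f - d) ^ (k - 2 - i) / fact (k - 2 - i)))"
      by (rule sum.reindex_bij_witness[of _ "\<lambda>i. (Suc i, k - 1 - i)" "\<lambda>(r, s). r - 1"])
         (use assms in \<open>auto simp: diff_diff_add\<close>)
    also have "\<dots> = (of_nat d + of_nat (f - d)) ^ (k - 2) / fact (k - 2) - of_nat d ^ (k - 2) / fact (k - 2)"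
      unfolding binomial_divided lessThan_Suc_atMost[symmetric] by simp
    finally show ?thesis using that by (simp add: diff_divide_distrib)
  qed
  have "fps_nth (\<Sum>(r, s)\<in>?R. zeta_hat_q r s) N = (\<Sum>(r, s)\<in>?R. \<Sum>(d, n, f, m)\<in>?S. ?g r s d (f - d))"
    unfolding fps_sum_nth by (rule sum.cong) (auto simp: zeta_hat_q_nth)
  also have "\<dots> = (\<Sum>(d, n, f, m)\<in>?S. \<Sum>(r, s)\<in>?R. ?g r s d (f - d))"
    unfolding split_def by (rule sum.swap)
  also have "\<dots> = (\<Sum>(d, n, f, m)\<in>?S. (of_nat f ^ (k - 2) - of_nat d ^ (k - 2)) / fact (k - 2))"
    by (intro sum.cong refl) (auto simp only: mem_Collect_eq prod.case inner)
  finally show ?thesis .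
qed

section \<open>Cancellation down to the diagonals\<close>

lemma sum_quads_restrict:
  "(\<Sum>(d, n, f, m) | (d, n, f, m) \<in> quads N \<and> P d n f m. g d n f m) =
   (\<Sum>(d, n, f, m)\<in>quads N. if P d n f m then g d n f m else (0::rat))"
  by (intro sum.mono_neutral_cong_left finite_quads) (auto split: if_splits)

text \<open>Swapping \<open>(d, n)\<close> with \<open>(f, m)\<close> turns the left-hand side into the sum of
  \<open>g f \<cdot> ([n < m, d < f] - [n > m, d > f])\<close>, which off the diagonals equals \<open>g f \<cdot> ([n < m] - [d > f])\<close>.
  The substitution \<open>d n + f m = (d + f) n + f (m - n)\<close> shows that the sum of the latter is zero.\<close>
lemma sum_quads_diagonals:
  fixes g :: "nat \<Rightarrow> rat"
  shows "(\<Sum>(d, n, f, m) | (d, n, f, m) \<in> quads N \<and> n < m \<and> d < f. g f - g d) =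
    (\<Sum>(d, n, f, m) | (d, n, f, m) \<in> quads N \<and> n = m \<and> f < d. g f) -
    (\<Sum>(d, n, f, m) | (d, n, f, m) \<in> quads N \<and> n < m \<and> d = f. g f)"
proof -
  let ?s = "\<lambda>P. \<Sum>(d, n, f, m) | (d, n, f, m) \<in> quads N \<and> P d n f m. g f"
  have swap: "(\<Sum>(d, n, f, m) | (d, n, f, m) \<in> quads N \<and> n < m \<and> d < f. g d) = ?s (\<lambda>d n f m. n > m \<and> d > f)"
    by (rule sum.reindex_bij_witness[of _ "\<lambda>(d, n, f, m). (f, m, d, n)" "\<lambda>(d, n, f, m). (f, m, d, n)"])
       (auto simp: quads_def add.commute)
  have shear: "?s (\<lambda>d n f m. n < m) = ?s (\<lambda>d n f m. f < d)"
  proof (rule sum.reindex_bij_witness[of _ "\<lambda>(d, n, f, m). (d - f, n, f, m + n)"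
        "\<lambda>(d, n, f, m). (d + f, n, f, m - n)"], goal_cases)
    case (2 y)
    then obtain d n f m where y: "y = (d, n, f, m)" "(d, n, f, m) \<in> quads N" "n < m" by (cases y) auto
    then obtain p where "m = n + p" "0 < p" by (metis less_imp_add_positive)
    with y show ?case by (auto simp: quads_def algebra_simps)
  next
    case (4 y)
    then obtain d n f m where y: "y = (d, n, f, m)" "(d, n, f, m) \<in> quads N" "f < d" by (cases y) auto
    then obtain p where "d = f + p" "0 < p" by (metis less_imp_add_positive)
    with y show ?case by (auto simp: quads_def algebra_simps)
  qed auto
  have "(\<Sum>(d, n, f, m) | (d, n, f, m) \<in> quads N \<and> n < m \<and> d < f. g f - g d) =
      ?s (\<lambda>d n f m. n < m \<and> d < f) - ?s (\<lambda>d n f m. n > m \<and> d > f)"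
    unfolding swap[symmetric] sum_subtractf[symmetric] by (rule sum.cong) auto
  also have "\<dots> = ?s (\<lambda>d n f m. n < m) - ?s (\<lambda>d n f m. f < d)
      + (?s (\<lambda>d n f m. n = m \<and> f < d) - ?s (\<lambda>d n f m. n < m \<and> d = f))"
    unfolding sum_quads_restrict sum_subtractf[symmetric] sum.distrib[symmetric]
    by (rule sum.cong) auto
  finally show ?thesis unfolding shear by simp
qed

section \<open>The diagonals as divisor sums\<close>

lemma finite_double_less: "finite {n::nat. 0 < n \<and> 2 * n < a}"
  by (rule finite_subset[of _ "{..a}"]) auto

text \<open>For \<open>n = m\<close> the equation becomes \<open>n * (d + f) = N\<close>. With
  \<open>D = d + f\<close>, the condition \<open>f < d\<close> is \<open>2 * f < D\<close>.\<close>

lemma sum_quads_diagonal_nm: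
  fixes g :: "nat \<Rightarrow> rat"
  shows "(\<Sum>(d, n, f, m) | (d, n, f, m) \<in> quads N \<and> n = m \<and> f < d. g f) =
    (\<Sum>(a, D)\<in>factor_pairs N. \<Sum>f | 0 < f \<and> 2 * f < D. g f)"
proof -
  have "(\<Sum>(a, D)\<in>factor_pairs N. \<Sum>f | 0 < f \<and> 2 * f < D. g f) =
     (\<Sum>(x, f)\<in>(SIGMA x:factor_pairs N. {f. 0 < f \<and> 2 * f < snd x}). g f)"
    by (subst sum.Sigma[symmetric]) (auto simp: finite_factor_pairs finite_double_less case_prod_unfold)
  also have "\<dots> = (\<Sum>(d, n, f, m) | (d, n, f, m) \<in> quads N \<and> n = m \<and> f < d. g f)"
  proof (rule sum.reindex_bij_witness[of _ "\<lambda>(d, n, f, m). ((n, d + f), f)"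
        "\<lambda>((a, D), f). (D - f, a, f, a)"], goal_cases)
    case (2 y)
    then obtain a D f where y: "y = ((a, D), f)" "(a, D) \<in> factor_pairs N" "0 < f" "f + f < D"
      by (cases y) auto
    then obtain p where "D = f + f + p" "0 < p" by (metis less_imp_add_positive)
    with y show ?case by (auto simp: quads_def factor_pairs_def algebra_simps)
  qed (auto simp: quads_def factor_pairs_def algebra_simps)
  finally show ?thesis ..
qed

text \<open>For \<open>d = f\<close> the equation becomes \<open>(n + m) * d = N\<close>, and the
  weight counts the \<open>n\<close> below half of \<open>a = n + m\<close>. The floor of
  \<open>(a - 1) / 2\<close> is written with a parity correction so that it splits linearly into
  separate divisor sums.\<close>

lemma sum_quads_diagonal_df:
  fixes g :: "nat \<Rightarrow> rat"
  shows "(\<Sum>(d, n, f, m) | (d, n, f, m) \<in> quads N \<and> n < m \<and> d = f. g f) =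
    (\<Sum>(a, D)\<in>factor_pairs N. (of_nat a - 1 - (if even a then 1 else 0)) / 2 * g D)"
proof -
  have card: "(of_nat a - 1 - (if even a then 1 else 0)) / 2 = (of_nat (card {n. 0 < n \<and> 2 * n < a}) :: rat)"
    if "a > 0" for a :: nat
  proof -
    have "{n. 0 < n \<and> 2 * n < a} = {1..(a - 1) div 2}" using that by auto
    then have c: "card {n. 0 < n \<and> 2 * n < a} = (a - 1) div 2" by simp
    from that obtain c where "a = 2 * c + 2 \<or> a = 2 * c + 1" by atomize_elim presburger
    then show ?thesis unfolding c by (elim disjE) simp_all
  qed
  have "(\<Sum>(a, D)\<in>factor_pairs N. (of_nat a - 1 - (if even a then 1 else 0)) / 2 * g D) =
     (\<Sum>x\<in>factor_pairs N. \<Sum>n | 0 < n \<and> 2 * n < fst x. g (snd x))"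
    by (rule sum.cong) (auto simp only: factor_pairs_def card sum_constant mem_Collect_eq split_def)
  also have "\<dots> = (\<Sum>(x, n)\<in>(SIGMA x:factor_pairs N. {n. 0 < n \<and> 2 * n < fst x}). g (snd x))"
    by (subst sum.Sigma) (auto simp: finite_factor_pairs finite_double_less)
  also have "\<dots> = (\<Sum>(d, n, f, m) | (d, n, f, m) \<in> quads N \<and> n < m \<and> d = f. g f)"
  proof (rule sum.reindex_bij_witness[of _ "\<lambda>(d, n, f, m). ((n + m, d), n)"
        "\<lambda>((a, D), n). (D, n, D, a - n)"], goal_cases)
    case (2 y)
    then obtain a D n where y: "y = ((a, D), n)" "(a, D) \<in> factor_pairs N" "0 < n" "n + n < a"
      by (cases y) auto
    then obtain p where "a = n + n + p" "0 < p" by (metis less_imp_add_positive)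
    with y show ?case by (auto simp: quads_def factor_pairs_def algebra_simps)
  qed (auto simp: quads_def factor_pairs_def algebra_simps)
  finally show ?thesis ..
qed

text \<open>A factor 2 moves from the cofactor to the divisor. This matches the parity correction in
  \<open>a\<close> from the count above with the parity of \<open>d\<close> in the Bernoulli
  identity.\<close>

lemma factor_pairs_even_swap:
  fixes h :: "nat \<Rightarrow> rat"
  shows "(\<Sum>(a, d)\<in>factor_pairs N. if even a then h (2 * d) else 0) =
         (\<Sum>(a, d)\<in>factor_pairs N. if even d then h d else 0)"
proof -
  have "(\<Sum>(a, d)\<in>factor_pairs N. if even a then h (2 * d) else 0) =
      (\<Sum>(a, d) | (a, d) \<in> factor_pairs N \<and> even a. h (2 * d))"
    by (intro sum.mono_neutral_cong_right finite_factor_pairs) (auto split: if_splits)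
  also have "\<dots> = (\<Sum>(a, d) | (a, d) \<in> factor_pairs N \<and> even d. h d)"
    by (rule sum.reindex_bij_witness[of _ "\<lambda>(a, d). (2 * a, d div 2)" "\<lambda>(a, d). (a div 2, 2 * d)"])
       (auto simp: factor_pairs_def elim!: evenE)
  also have "\<dots> = (\<Sum>(a, d)\<in>factor_pairs N. if even d then h d else 0)"
    by (intro sum.mono_neutral_cong_left finite_factor_pairs) (auto split: if_splits)
  finally show ?thesis .
qed

section \<open>Faulhaber's formula and the identity at a single divisor\<close>

text \<open>Comparison of exponential generating functions. The convention \<open>B_1 = +1/2\<close>
  is what makes the sum include its endpoint \<open>E\<close>.\<close>

lemma faulhaber:
  "(\<Sum>f\<in>{1..E}. of_nat f ^ p / fact p) =
   (\<Sum>j\<le>p. bernoulli j / fact j * (of_nat E ^ (p + 1 - j) / fact (p + 1 - j)))"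
proof -
  define G :: "rat fps" where "G = fps_X / (1 - fps_exp (- 1))"
  \<comment> \<open>\<open>1 - fps_exp (- 1)\<close> has no constant term and is no unit; removing
    one factor \<open>fps_X\<close> leaves the unit \<open>H\<close>, so \<open>G\<close> is a true
    inverse.\<close>
  define H :: "rat fps" where "H = fps_shift 1 (1 - fps_exp (- 1))"
  have H: "1 - fps_exp (- 1) = fps_X * H"
    by (rule fps_ext) (auto simp: H_def gr0_conv_Suc)
  have "fps_nth H 0 = 1" by (simp add: H_def)
  then have "is_unit H" by (simp add: fps_is_unit_iff)
  moreover have "G = 1 / H" unfolding G_def H
    by (metis div_mult_mult1 mult.right_neutral fps_X_neq_zero)
  ultimately have "G * H = 1" by simp
  then have GX: "G * (1 - fps_exp (- 1)) = fps_X" unfolding H by (simp add: mult.left_commute)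
  have tele: "(1 - fps_exp (- 1)) * (\<Sum>f\<in>{1..E}. fps_exp (of_nat f)) = fps_exp (of_nat E) - (1 :: rat fps)"
  proof (induction E)
    case (Suc E)
    have "fps_exp (- 1) * fps_exp (of_nat (Suc E)) = (fps_exp (of_nat E) :: rat fps)"
      by (simp flip: fps_exp_add_mult)
    with Suc show ?case by (simp add: algebra_simps)
  qed simp
  have "fps_X * (\<Sum>f\<in>{1..E}. fps_exp (of_nat f)) = G * (fps_exp (of_nat E) - 1)"
    unfolding tele[symmetric] GX[symmetric] by (simp add: mult.assoc)
  from arg_cong[OF this, of "\<lambda>F. fps_nth F (Suc p)"]
  have "(\<Sum>f\<in>{1..E}. of_nat f ^ p / fact p) =
      (\<Sum>j\<le>Suc p. fps_nth G j * fps_nth (fps_exp (of_nat E) - 1) (Suc p - j))"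
    by (simp add: fps_sum_nth fps_mult_nth[of G] atLeast0AtMost del: sum.atMost_Suc)
  also have "\<dots> = (\<Sum>j\<le>p. bernoulli j / fact j * (of_nat E ^ (p + 1 - j) / fact (p + 1 - j)))"
  proof -
    \<comment> \<open>The term \<open>j = Suc p\<close> drops out because
      \<open>fps_exp (of_nat E) - 1\<close> has no constant term.\<close>
    have "fps_nth (fps_exp (of_nat E) - 1) (Suc p - j) = (of_nat E ^ (p + 1 - j) / fact (p + 1 - j) :: rat)"
      if "j \<le> p" for j
      using that by simp
    then show ?thesis unfolding sum.atMost_Suc by (simp add: bernoulli_def G_def)
  qed
  finally show ?thesis .
qed

text \<open>The left side is what one divisor \<open>D\<close> contributes to
  \<open>zeta_q k\<close> and the two Bernoulli sums of \<open>E_q k\<close>. It equals a rescaled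
  Faulhaber polynomial up to boundary terms that depend on the parity of \<open>D\<close>.\<close>

lemma sum_divisor_identity:
  fixes D k :: nat
  assumes "k \<ge> 3" "D > 0"
  defines "c \<equiv> \<lambda>j. 2 ^ j * bernoulli j / fact j"
  defines "x \<equiv> of_nat D :: rat"
  shows "x ^ (k - 1) / fact (k - 1) + (\<Sum>j = 2..k - 2. c j * (x ^ (k - j - 1) / fact (k - j - 1)))
    + (\<Sum>(j, l)\<in>{(j, l). j \<le> k - 2 \<and> 1 \<le> l \<and> l \<le> k - j - 1 \<and> (l, j) \<noteq> (1, 0)}.
         (- 1) ^ l * 2 ^ j * bernoulli j / (fact j * fact l) *
         (if odd D then x ^ (k - j - l - 1) / fact (k - j - l - 1) else 0)) =
    2 ^ (k - 1) / fact (k - 2) * (\<Sum>f | 0 < f \<and> 2 * f < D. of_nat f ^ (k - 2))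
    + (if even D then x ^ (k - 2) / fact (k - 2) else 0)"
proof -
  \<comment> \<open>Faulhaber's formula for the single summand \<open>f = 1\<close> with exponent 0
    reads \<open>1 = bernoulli 0\<close>.\<close>
  have b0: "c 0 = 1"
    using faulhaber[where E = 1 and p = 0] by (simp add: c_def)
  have b1: "c 1 = 1" using bernoulli_1 by (simp add: c_def)
  \<comment> \<open>Faulhaber's polynomial for exponent \<open>k - 2\<close>, taken at
    \<open>y / 2\<close> and multiplied by \<open>2 ^ (k - 1)\<close>; the powers of 2 left over are
    the \<open>2 ^ j\<close> in \<open>c j\<close>.\<close>
  define J where "J y = (\<Sum>j\<le>k - 2. c j * (y ^ (k - 1 - j) / fact (k - 1 - j)))" for y :: rat
  have J: "J (2 * of_nat E) = 2 ^ (k - 1) / fact (k - 2) * (\<Sum>f\<in>{1..E}. of_nat f ^ (k - 2))" for E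
  proof -
    have "2 ^ (k - 1) / fact (k - 2) * (\<Sum>f\<in>{1..E}. of_nat f ^ (k - 2)) =
        2 ^ (k - 1) * (\<Sum>f\<in>{1..E}. of_nat f ^ (k - 2) / fact (k - 2) :: rat)"
      by (simp flip: sum_divide_distrib)
    also have "\<dots> = (\<Sum>j\<le>k - 2. 2 ^ (k - 1) * (bernoulli j / fact j * (of_nat E ^ (k - 1 - j) / fact (k - 1 - j))))"
      using assms(1) by (simp only: faulhaber sum_distrib_left Suc_eq_plus1[symmetric])
        (simp add: Suc_diff_Suc numeral_2_eq_2)
    also have "\<dots> = J (2 * of_nat E)"
      unfolding J_def
    proof (rule sum.cong)
      fix j assume "j \<in> {..k - 2}"
      then have "(2::rat) ^ (k - 1) = 2 ^ j * 2 ^ (k - 1 - j)"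
        using assms(1) by (simp flip: power_add)
      then show "2 ^ (k - 1) * (bernoulli j / fact j * (of_nat E ^ (k - 1 - j) / fact (k - 1 - j))) =
          c j * ((2 * of_nat E) ^ (k - 1 - j) / fact (k - 1 - j))"
        by (simp add: c_def power_mult_distrib)
    qed simp
    finally show ?thesis ..
  qed
  have Jx: "J x = x ^ (k - 1) / fact (k - 1) + x ^ (k - 2) / fact (k - 2)
      + (\<Sum>j = 2..k - 2. c j * (x ^ (k - j - 1) / fact (k - j - 1)))"
  proof -
    have "{..k - 2} = insert 0 (insert 1 {2..k - 2})" using assms(1) by auto
    then show ?thesis unfolding J_def
      using b0 b1 by (simp add: diff_diff_add add.commute numeral_2_eq_2)
  qed
  show ?thesis
  proof (cases "even D")
    case True
    then obtain E where E: "D = 2 * E" by blast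
    with assms have "E > 0" by simp
    \<comment> \<open>The endpoint \<open>f = E\<close> violates the strict bound. It contributes
      \<open>2 * x ^ (k - 2) / fact (k - 2)\<close>: one copy cancels the term \<open>j = 1\<close>
      of \<open>J x\<close>, the other is the even case on the right.\<close>
    then have "{1..E} = insert E {f. 0 < f \<and> 2 * f < D}" using E by auto
    then have "J x = 2 ^ (k - 1) / fact (k - 2) * (of_nat E ^ (k - 2) + (\<Sum>f | 0 < f \<and> 2 * f < D. of_nat f ^ (k - 2)))"
      using J[of E] E by (simp add: x_def finite_double_less)
    moreover have "2 ^ (k - 1) * of_nat E ^ (k - 2) = 2 * x ^ (k - 2)"
    proof -
      have "(2::rat) ^ (k - 1) = 2 * 2 ^ (k - 2)" using assms(1) by (simp flip: power_Suc add: Suc_diff_Suc numeral_2_eq_2)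
      then show ?thesis by (simp add: x_def E power_mult_distrib)
    qed
    ultimately have "J x = 2 * x ^ (k - 2) / fact (k - 2)
        + 2 ^ (k - 1) / fact (k - 2) * (\<Sum>f | 0 < f \<and> 2 * f < D. of_nat f ^ (k - 2))"
      by (simp add: distrib_left)
    with Jx True show ?thesis by (simp add: case_prod_unfold)
  next
    case False
    then obtain E where E: "D = 2 * E + 1" by (blast elim: oddE)
    let ?R = "{(j, l). j \<le> k - 2 \<and> 1 \<le> l \<and> l \<le> k - j - 1 \<and> (l, j) \<noteq> (1, 0)}"
    let ?h = "\<lambda>j l. (- 1) ^ l * 2 ^ j * bernoulli j / (fact j * fact l) * (x ^ (k - j - l - 1) / fact (k - j - l - 1))"
    have finR: "finite ?R" by (rule finite_subset[of _ "{..k} \<times> {..k}"]) auto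
    have "{f. 0 < f \<and> 2 * f < D} = {1..E}" using E by auto
    then have "2 ^ (k - 1) / fact (k - 2) * (\<Sum>f | 0 < f \<and> 2 * f < D. of_nat f ^ (k - 2)) = J (x - 1)"
      using J[of E] E by (simp add: x_def)
    also have "\<dots> = (\<Sum>j\<le>k - 2. \<Sum>l\<le>k - 1 - j. ?h j l)"
      unfolding J_def
    proof (rule sum.cong)
      fix j assume "j \<in> {..k - 2}"
      have "(x - 1) ^ (k - 1 - j) / fact (k - 1 - j) = (- 1 + x) ^ (k - 1 - j) / fact (k - 1 - j)"
        by simp
      then show "c j * ((x - 1) ^ (k - 1 - j) / fact (k - 1 - j)) = (\<Sum>l\<le>k - 1 - j. ?h j l)"
        unfolding binomial_divided by (simp add: sum_distrib_left c_def diff_diff_add add_ac mult_ac)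
    qed simp
    also have "\<dots> = (\<Sum>(j, l)\<in>(SIGMA j:{..k - 2}. {..k - 1 - j}). ?h j l)"
      by (rule sum.Sigma) auto
    \<comment> \<open>The column \<open>l = 0\<close> restores \<open>J x\<close>, and the pair
      \<open>j = 0\<close>, \<open>l = 1\<close> cancels the term \<open>j = 1\<close> of
      \<open>J x\<close>. This is why \<open>E_q\<close> excludes that pair.\<close>
    also have "(SIGMA j:{..k - 2}. {..k - 1 - j}) = insert (0, 1) ((\<lambda>j. (j, 0)) ` {..k - 2} \<union> ?R)"
      using assms(1) by (auto simp: diff_commute)
    also have "(\<Sum>(j, l)\<in>\<dots>. ?h j l) = ?h 0 1 + ((\<Sum>j\<le>k - 2. ?h j 0) + (\<Sum>(j, l)\<in>?R. ?h j l))"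
      using finR by (subst sum.insert, simp, force, subst sum.union_disjoint)
        (auto simp: sum.reindex inj_on_def)
    also have "?h 0 1 = - (x ^ (k - 2) / fact (k - 2))"
      using b0 by (simp add: c_def numeral_2_eq_2)
    also have "(\<Sum>j\<le>k - 2. ?h j 0) = J x"
      by (simp add: J_def c_def diff_commute)
    finally show ?thesis using Jx False by simp
  qed
qed

section \<open>Assembly of the divisor sums\<close>

theorem theorem1p3:
  fixes k :: nat
  assumes "even k" and "k \<ge> 4"
  shows "zeta_q k =
    fps_const (2 ^ (k - 1)) * (\<Sum>(r, s)\<in>{(r, s). r + s = k \<and> r \<ge> 1 \<and> s \<ge> 2}. zeta_hat_q r s)
    - E_q k"
proof (rule fps_ext)
  fix N
  let ?P = "factor_pairs N"
  let ?F = "fact (k - 2) :: rat"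
  define R where "R = {(j, l). j \<le> k - 2 \<and> 1 \<le> l \<and> l \<le> k - j - 1 \<and> (l, j) \<noteq> (1, 0)}"
  let ?S = "\<lambda>D. \<Sum>f | 0 < f \<and> 2 * f < D. of_nat f ^ (k - 2) :: rat"
  \<comment> \<open>The left side of \<open>sum_divisor_identity\<close> at
    \<open>d\<close>.\<close>
  let ?z = "\<lambda>d. of_nat d ^ (k - 1) / fact (k - 1)
    + (\<Sum>j = 2..k - 2. 2 ^ j * bernoulli j / fact j * (of_nat d ^ (k - j - 1) / fact (k - j - 1)))
    + (\<Sum>(j, l)\<in>R. (- 1) ^ l * 2 ^ j * bernoulli j / (fact j * fact l) *
         (if odd d then of_nat d ^ (k - j - l - 1) / fact (k - j - l - 1) else 0))"
  note E = E_q_def[of k, folded R_def] and identity = sum_divisor_identity[of k, folded R_def]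
  have pow2: "(2::rat) ^ (k - 1) = 2 * 2 ^ (k - 2)"
    using assms(2) by (simp flip: power_Suc add: Suc_diff_Suc numeral_2_eq_2)
  have hat: "fps_nth (\<Sum>(r, s)\<in>{(r, s). r + s = k \<and> r \<ge> 1 \<and> s \<ge> 2}. zeta_hat_q r s) N =
      (\<Sum>(a, d)\<in>?P. ?S d / ?F) -
      (\<Sum>(a, d)\<in>?P. (of_nat a - 1 - (if even a then 1 else 0)) / 2 * (of_nat d ^ (k - 2) / ?F))"
  proof -
    have "k \<ge> 2" using assms(2) by simp
    then show ?thesis
      by (simp only: sum_zeta_hat_q_nth diff_divide_distrib[of _ _ ?F] sum_divide_distrib[of _ _ ?F]
          sum_quads_diagonals[where g = "\<lambda>f. of_nat f ^ (k - 2) / ?F"]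
          sum_quads_diagonal_nm sum_quads_diagonal_df)
  qed
  \<comment> \<open>The operator \<open>q d/dq\<close> multiplies the coefficient by
    \<open>N = a * d\<close>. The factor \<open>d\<close> raises the power, \<open>k - 2\<close>
    completes the factorial, and \<open>a\<close> remains as the weight.\<close>
  have deriv: "1 / of_nat (k - 2) * fps_nth (fps_X * fps_deriv (zeta_q (k - 2))) N =
      (\<Sum>(a, d)\<in>?P. of_nat a * of_nat d ^ (k - 2) / ?F)"
  proof -
    have k: "k - 2 = Suc (k - 3)" using assms(2) by simp
    have "fps_nth (fps_X * fps_deriv (zeta_q (k - 2))) N = of_nat N * fps_nth (zeta_q (k - 2)) N"
      by (cases N) auto
    also have "1 / of_nat (k - 2) * \<dots> = (\<Sum>(a, d)\<in>?P. of_nat N * (of_nat d ^ (k - 3) / fact (k - 3)) / of_nat (k - 2))"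
      using assms(2) by (simp add: zeta_q_nth sum_distrib_left sum_divide_distrib case_prod_unfold mult.commute)
    also have "\<dots> = (\<Sum>(a, d)\<in>?P. of_nat a * of_nat d ^ (k - 2) / ?F)"
      unfolding k by (rule sum.cong) (auto simp: factor_pairs_def fact_Suc mult_ac simp del: of_nat_Suc)
    finally show ?thesis .
  qed
  \<comment> \<open>\<open>E_q k\<close> is moved to the left, so that both sides become sums over
    the same factor pairs.\<close>
  have "fps_nth (zeta_q k + E_q k) N =
      2 ^ (k - 2) * (\<Sum>(a, d)\<in>?P. of_nat d ^ (k - 2) / ?F)
      - 2 ^ (k - 2) * (\<Sum>(a, d)\<in>?P. of_nat a * of_nat d ^ (k - 2) / ?F)
      + (\<Sum>(a, d)\<in>?P. ?z d)"
  proof -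
    have even: "(\<Sum>j = 2..k - 2. 2 ^ j * bernoulli j / fact j * fps_nth (zeta_q (k - j)) N) =
      (\<Sum>x\<in>?P. \<Sum>j = 2..k - 2. 2 ^ j * bernoulli j / fact j * (of_nat (snd x) ^ (k - j - 1) / fact (k - j - 1)))"
      (is "?L = _")
    proof -
      have "?L = (\<Sum>j = 2..k - 2. \<Sum>x\<in>?P. 2 ^ j * bernoulli j / fact j * (of_nat (snd x) ^ (k - j - 1) / fact (k - j - 1)))"
        by (intro sum.cong refl, subst zeta_q_nth) (use assms(2) in \<open>auto simp: case_prod_unfold sum_distrib_left\<close>)
      then show ?thesis by (simp only: sum.swap[of _ ?P])
    qed
    have odd: "(\<Sum>y\<in>R. (- 1) ^ snd y * 2 ^ fst y * bernoulli (fst y) / (fact (fst y) * fact (snd y)) *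
        fps_nth (zeta_odd_q (k - fst y - snd y)) N) =
      (\<Sum>x\<in>?P. \<Sum>y\<in>R. (- 1) ^ snd y * 2 ^ fst y * bernoulli (fst y) / (fact (fst y) * fact (snd y)) *
         (if odd (snd x) then of_nat (snd x) ^ (k - fst y - snd y - 1) / fact (k - fst y - snd y - 1) else 0))"
      by (simp only: zeta_odd_q_nth case_prod_unfold sum_distrib_left sum.swap[of _ ?P])
    have "fps_nth (zeta_q k + E_q k) N = fps_nth (zeta_q k) N + (2 ^ (k - 2) * fps_nth (zeta_q (k - 1)) N
      - 2 ^ (k - 2) * (1 / of_nat (k - 2) * fps_nth (fps_X * fps_deriv (zeta_q (k - 2))) N)
      + (\<Sum>j = 2..k - 2. 2 ^ j * bernoulli j / fact j * fps_nth (zeta_q (k - j)) N)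
      + (\<Sum>y\<in>R. (- 1) ^ snd y * 2 ^ fst y * bernoulli (fst y) / (fact (fst y) * fact (snd y)) *
          fps_nth (zeta_odd_q (k - fst y - snd y)) N))"
      by (simp add: E fps_sum_nth case_prod_unfold del: fps_mult_fps_X_deriv_shift)
    also have "\<dots> = 2 ^ (k - 2) * (\<Sum>(a, d)\<in>?P. of_nat d ^ (k - 2) / ?F)
      - 2 ^ (k - 2) * (\<Sum>(a, d)\<in>?P. of_nat a * of_nat d ^ (k - 2) / ?F)
      + (\<Sum>(a, d)\<in>?P. ?z d)"
    proof -
      have "k - 1 - 1 = k - 2" by simp
      then have "fps_nth (zeta_q (k - 1)) N = (\<Sum>(a, d)\<in>?P. of_nat d ^ (k - 2) / ?F)"
        using assms(2) zeta_q_nth[of "k - 1" N] by simp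
      moreover have "fps_nth (zeta_q k) N = (\<Sum>x\<in>?P. of_nat (snd x) ^ (k - 1) / fact (k - 1))"
        using assms(2) zeta_q_nth[of k N] by (simp add: case_prod_unfold)
      ultimately show ?thesis
        unfolding deriv even odd case_prod_unfold sum.distrib by (simp only: ac_simps)
    qed
    finally show ?thesis .
  qed
  also have "(\<Sum>(a, d)\<in>?P. ?z d) = (\<Sum>(a, d)\<in>?P. 2 ^ (k - 1) / ?F * ?S d) +
      (\<Sum>(a, d)\<in>?P. if even d then of_nat d ^ (k - 2) / ?F else 0)"
    unfolding sum.distrib[symmetric]
    by (rule sum.cong) (use assms(2) in \<open>auto simp only: factor_pairs_def mem_Collect_eq prod.case identity\<close>)
  also have "(\<Sum>(a, d)\<in>?P. if even d then of_nat d ^ (k - 2) / ?F else 0) =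
      (\<Sum>(a, d)\<in>?P. if even a then of_nat (2 * d) ^ (k - 2) / ?F else 0)"
    by (rule factor_pairs_even_swap[symmetric])
  also have "2 ^ (k - 2) * (\<Sum>(a, d)\<in>?P. of_nat d ^ (k - 2) / ?F)
      - 2 ^ (k - 2) * (\<Sum>(a, d)\<in>?P. of_nat a * of_nat d ^ (k - 2) / ?F)
      + ((\<Sum>(a, d)\<in>?P. 2 ^ (k - 1) / ?F * ?S d) +
         (\<Sum>(a, d)\<in>?P. if even a then of_nat (2 * d) ^ (k - 2) / ?F else 0)) =
      2 ^ (k - 1) * fps_nth (\<Sum>(r, s)\<in>{(r, s). r + s = k \<and> r \<ge> 1 \<and> s \<ge> 2}. zeta_hat_q r s) N"
    \<comment> \<open>The identity now holds pair by pair: \<open>2 ^ (k - 1)\<close> times the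
      halved weight gives \<open>2 ^ (k - 2)\<close>, and the even case agrees since
      \<open>(2 * d) ^ (k - 2) = 2 ^ (k - 2) * d ^ (k - 2)\<close>.\<close>
    unfolding hat right_diff_distrib sum_distrib_left[of _ _ ?P] sum.distrib[symmetric] sum_subtractf[symmetric] pow2
    by (rule sum.cong) (auto simp: power_mult_distrib field_simps)
  finally show "fps_nth (zeta_q k) N = fps_nth (fps_const (2 ^ (k - 1)) *
      (\<Sum>(r, s)\<in>{(r, s). r + s = k \<and> r \<ge> 1 \<and> s \<ge> 2}. zeta_hat_q r s) - E_q k) N"
    by simp
qed

end
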